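(* Let $\mathcal H$ be a finite-dimensional real Hilbert space and let $f\in\Gamma_0(\mathcal H)$ be such that $\operatorname{lev}_{\leq 0}f\neq\varnothing$. Then the set-valued operator $G_f$ is upper semicontinuous at every point of $\operatorname{int}\operatorname{dom}f$.
   Context: $\Gamma_0(\mathcal H)$ is the set of proper convex lower semicontinuous functions $\mathcal H\to]-\infty,+\infty]$; $\operatorname{dom}f=\{f<+\infty\}$; $\operatorname{lev}_{\leq 0}f=\{x: f(x)\leq 0\}$. $\partial f$ is the convex subdifferential. The subgradient projector $G_f:\mathcal H\to 2^{\mathcal H}$ is $G_fx=\{x\}$ if $f(x)\leq 0$ and $G_fx=\{x-\frac{f(x)}{\|u\|^2}u : u\in\partial f(x)\}$ if $f(x)>0$ (subgradients at points where $f>0$ are nonzero because $\operatorname{lev}_{\leq 0}f\neq\varnothing$). A set-valued $A:X\to2^Y$ between metric spaces is upper semicontinuous at a point $x$ with $Ax\neq\varnothing$ if for every neighborhood $V$ of the set $Ax$ there is a neighborhood $W$ of $x$ with $\bigcup_{w\in W}Aw\subset V$. *)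

theory Defs
  imports "HOL-Analysis.Analysis"
begin

definition edom :: "('a \<Rightarrow> ereal) \<Rightarrow> 'a set" where
  "edom f = {x. f x < \<infinity>}"

definition proper_fun :: "('a \<Rightarrow> ereal) \<Rightarrow> bool" where
  "proper_fun f \<longleftrightarrow> (\<forall>x. f x \<noteq> -\<infinity>) \<and> edom f \<noteq> {}"

(* For a function without the value -\<infinity>, the right-hand side never involves \<infinity> + (-\<infinity>). *)
definition econvex :: "('a::real_vector \<Rightarrow> ereal) \<Rightarrow> bool" where
  "econvex f \<longleftrightarrow> (\<forall>x y. \<forall>a::real. 0 < a \<and> a < 1 \<longrightarrow>
     f (a *\<^sub>R x + (1 - a) *\<^sub>R y) \<le> ereal a * f x + ereal (1 - a) * f y)"

definition lower_semicont :: "('a::topological_space \<Rightarrow> ereal) \<Rightarrow> bool" where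
  "lower_semicont f \<longleftrightarrow> (\<forall>x. f x \<le> Liminf (nhds x) f)"

definition Gamma0 :: "('a::real_inner \<Rightarrow> ereal) set" where
  "Gamma0 = {f. proper_fun f \<and> econvex f \<and> lower_semicont f}"

definition lev_le0 :: "('a \<Rightarrow> ereal) \<Rightarrow> 'a set" where
  "lev_le0 f = {x. f x \<le> 0}"

(* If f is proper and f x = \<infinity>, this set is empty. *)
definition subdiff :: "('a::real_inner \<Rightarrow> ereal) \<Rightarrow> 'a \<Rightarrow> 'a set" where
  "subdiff f x = {u. \<forall>y. ereal ((y - x) \<bullet> u) + f x \<le> f y}"

(* Subgradients at points where f is positive are nonzero as soon as lev_le0 f is nonempty
   (see subdiff_nonzero below), so the division by zero convention plays no role then. *)
definition subgrad_proj :: "('a::real_inner \<Rightarrow> ereal) \<Rightarrow> 'a \<Rightarrow> 'a set" where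
  "subgrad_proj f x =
     (if f x \<le> 0 then {x}
      else {x - (real_of_ereal (f x) / (norm u)\<^sup>2) *\<^sub>R u | u. u \<in> subdiff f x})"

(* A neighbourhood of a set S is a set V whose interior contains S. *)
definition upper_semicont_at :: "('a::metric_space \<Rightarrow> 'b::metric_space set) \<Rightarrow> 'a \<Rightarrow> bool" where
  "upper_semicont_at A x \<longleftrightarrow> A x \<noteq> {} \<and>
     (\<forall>V. A x \<subseteq> interior V \<longrightarrow> (\<exists>W. x \<in> interior W \<and> (\<Union>w\<in>W. A w) \<subseteq> V))"

lemma subdiff_nonzero:
  assumes "lev_le0 f \<noteq> {}" "f x > 0" "u \<in> subdiff f x"
  shows "u \<noteq> 0"
proof
  assume "u = 0"
  obtain y where y: "f y \<le> 0" using assms(1) by (auto simp: lev_le0_def)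
  have "f x \<le> f y" using assms(3) \<open>u = 0\<close> by (auto simp: subdiff_def zero_ereal_def[symmetric])
  with y assms(2) show False by (meson leD order_trans)
qed

end

(*
  If f x <= 0, the subgradient inequality at w tested at x gives |q - w| <= |w - x| for every
  q in G_f w, so G_f w shrinks to G_f x = {x} as w -> x. If f x > 0, then f is bounded and
  continuous near x, so its subgradients are bounded there; by compactness of balls and closedness
  of the graph of the subdifferential, any q_n in G_f w_n with w_n -> x subconverges to a point of
  G_f x. Nonemptiness of the subdifferential at x comes from the same closedness argument, applied
  to the subgradients c (x - z) at the local minimisers z of f + c/2 |. - x|^2 as c -> oo.
*)

theory Submission
  imports Defs
begin

section \<open>Coordinates and compactness of balls in finite dimension\<close>

text \<open>Gram-Schmidt turns \<open>B\<close> into an orthogonal spanning set \<open>C\<close>.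
  The coordinates are then the quotients \<open>(x \<bullet> b) / (b \<bullet> b)\<close>, and
  Cauchy-Schwarz bounds each of them by \<open>norm x / norm b\<close>.\<close>

lemma finite_span_bounded_coordinates:
  fixes B :: "'a::real_inner set"
  assumes "finite B" "span B = UNIV"
  obtains C :: "'a set" and K and c :: "'a \<Rightarrow> 'a \<Rightarrow> real"
  where "finite C" "K > 0" "\<And>x. (\<Sum>b\<in>C. c x b *\<^sub>R b) = x"
    "\<And>x b. b \<in> C \<Longrightarrow> \<bar>c x b\<bar> \<le> K * norm x"
proof -
  obtain C :: "'a set" where C: "finite C" "span C = UNIV" "pairwise orthogonal C"
    using basis_orthogonal[OF assms(1)] assms(2) by auto
  define c where "c x b = (x \<bullet> b) / (b \<bullet> b)" for x b :: 'a
  \<comment> \<open>The summand 1 makes \<open>K\<close> positive even if \<open>C\<close> is empty.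
    If 0 belongs to \<open>C\<close>, its term is \<open>1 / 0 = 0\<close>.\<close>
  define K where "K = 1 + (\<Sum>b\<in>C. 1 / norm b)"
  show thesis
  proof
    show "finite C" by fact
    show "K > 0" unfolding K_def by (intro add_pos_nonneg sum_nonneg) auto
    show "(\<Sum>b\<in>C. c x b *\<^sub>R b) = x" for x
    proof -
      have "x \<in> span C" using C(2) by simp
      then obtain t where t: "x = (\<Sum>b\<in>C. t b *\<^sub>R b)"
        using span_finite[OF C(1)] by auto
      have "c x b *\<^sub>R b = t b *\<^sub>R b" if b: "b \<in> C" for b
      proof -
        have "x \<bullet> b = (\<Sum>a\<in>C. t a * (a \<bullet> b))"
          by (simp add: t inner_sum_left)
        also have "\<dots> = (\<Sum>a\<in>C. if a = b then t b * (b \<bullet> b) else 0)"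
          using C(3) b by (intro sum.cong) (auto simp: pairwise_def orthogonal_def)
        also have "\<dots> = t b * (b \<bullet> b)"
          using b C(1) by simp
        \<comment> \<open>For \<open>b = 0\<close> the coefficients may differ, but both sides are
          multiples of the zero vector.\<close>
        finally show ?thesis by (cases "b = 0") (auto simp: c_def)
      qed
      then have "(\<Sum>b\<in>C. c x b *\<^sub>R b) = (\<Sum>b\<in>C. t b *\<^sub>R b)"
        by (rule sum.cong[OF refl])
      then show ?thesis using t by simp
    qed
    show "\<bar>c x b\<bar> \<le> K * norm x" if b: "b \<in> C" for x b
    proof -
      have "1 / norm b \<le> (\<Sum>b\<in>C. 1 / norm b)"
        using C(1) b by (intro member_le_sum) auto
      then have K: "1 / norm b \<le> K" by (simp add: K_def)
      have "\<bar>c x b\<bar> = \<bar>x \<bullet> b\<bar> / (norm b)\<^sup>2"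
        by (simp add: c_def power2_norm_eq_inner)
      also have "\<dots> \<le> (norm x * norm b) / (norm b)\<^sup>2"
        by (intro divide_right_mono Cauchy_Schwarz_ineq2) auto
      also have "\<dots> = (1 / norm b) * norm x"
        by (cases "b = 0") (auto simp: power2_eq_square)
      also have "\<dots> \<le> K * norm x"
        using K by (intro mult_right_mono) auto
      finally show ?thesis .
    qed
  qed
qed

text \<open>Adding a vector \<open>b\<close> to \<open>C\<close> turns the box into its Minkowski
  sum with a compact segment along \<open>b\<close>, and sums of two compact sets are
  compact.\<close>

lemma compact_coordinate_box:
  fixes C :: "'a::real_normed_vector set"
  assumes "finite C"
  shows "compact {\<Sum>b\<in>C. t b *\<^sub>R b | t. \<forall>b\<in>C. \<bar>t b\<bar> \<le> M}"
  using assms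
proof (induction C)
  case empty
  then show ?case by simp
next
  case (insert b C)
  have "{\<Sum>b\<in>insert b C. t b *\<^sub>R b | t. \<forall>b\<in>insert b C. \<bar>t b\<bar> \<le> M}
      = {x + y | x y. x \<in> (\<lambda>s. s *\<^sub>R b) ` {-M..M} \<and>
           y \<in> {\<Sum>b\<in>C. t b *\<^sub>R b | t. \<forall>b\<in>C. \<bar>t b\<bar> \<le> M}}" (is "?L = ?R")
  proof (intro equalityI subsetI)
    fix z assume "z \<in> ?L"
    then obtain t where "z = t b *\<^sub>R b + (\<Sum>b\<in>C. t b *\<^sub>R b)" "\<bar>t b\<bar> \<le> M" "\<forall>b\<in>C. \<bar>t b\<bar> \<le> M"
      using insert by auto
    then show "z \<in> ?R" by (fastforce simp: abs_le_iff)
  next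
    fix z assume "z \<in> ?R"
    then obtain s t where z: "z = s *\<^sub>R b + (\<Sum>b\<in>C. t b *\<^sub>R b)" "\<bar>s\<bar> \<le> M" "\<forall>b\<in>C. \<bar>t b\<bar> \<le> M"
      by (auto simp: abs_le_iff)
    \<comment> \<open>Since \<open>b\<close> is not in \<open>C\<close>, overwriting
      \<open>t\<close> at \<open>b\<close> leaves the sum over \<open>C\<close> unchanged.\<close>
    have "(\<Sum>a\<in>C. (t(b := s)) a *\<^sub>R a) = (\<Sum>b\<in>C. t b *\<^sub>R b)"
      using insert by (intro sum.cong) auto
    then have "z = (\<Sum>a\<in>insert b C. (t(b := s)) a *\<^sub>R a)"
      using insert z by simp
    moreover have "\<forall>a\<in>insert b C. \<bar>(t(b := s)) a\<bar> \<le> M"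
      using z by auto
    ultimately show "z \<in> ?L" by blast
  qed
  moreover have "compact ((\<lambda>s. s *\<^sub>R b) ` {-M..M})"
    by (intro compact_continuous_image continuous_intros) auto
  ultimately show ?case using compact_sums[OF _ insert.IH] by presburger
qed

text \<open>The coordinate bound places the ball inside a compact coordinate box, where it is a
  closed subset.\<close>

lemma compact_cball_finite_span:
  fixes B :: "'a::real_inner set"
  assumes "finite B" "span B = UNIV"
  shows "compact (cball (x::'a) r)"
proof -
  obtain C :: "'a set" and K and c :: "'a \<Rightarrow> 'a \<Rightarrow> real" where C: "finite C" "K > 0" "\<And>x. (\<Sum>b\<in>C. c x b *\<^sub>R b) = x"
    "\<And>x b. b \<in> C \<Longrightarrow> \<bar>c x b\<bar> \<le> K * norm x"
    by (rule finite_span_bounded_coordinates[OF assms]) blast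
  define T where "T = {\<Sum>b\<in>C. t b *\<^sub>R b | t. \<forall>b\<in>C. \<bar>t b\<bar> \<le> K * (norm x + r)}"
  have "compact T"
    unfolding T_def by (rule compact_coordinate_box[OF C(1)])
  moreover have "y \<in> T" if "y \<in> cball x r" for y
  proof -
    have "norm y \<le> norm x + r"
      using that norm_triangle_ineq[of x "y - x"] by (simp add: dist_norm norm_minus_commute)
    then have "K * norm y \<le> K * (norm x + r)" using C(2) by simp
    then have "\<forall>b\<in>C. \<bar>c y b\<bar> \<le> K * (norm x + r)" using C(4) order_trans by blast
    then show ?thesis unfolding T_def using C(3)[of y] by force
  qed
  ultimately have "compact (T \<inter> cball x r)" "T \<inter> cball x r = cball x r"
    by (auto intro: compact_Int_closed)
  then show ?thesis by simp
qed

section \<open>Local boundedness and continuity of convex functions\<close>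

text \<open>The sublevel set \<open>S\<close> is convex and contains short segments through
  \<open>x\<close> along each vector of \<open>C\<close>. Averages of points on these segments fill
  a ball around \<open>x\<close>, which gives the upper bound; convexity turns it into a lower bound
  by reflection in \<open>x\<close>.\<close>

lemma convex_on_ball_locally_bounded:
  fixes g :: "'a::real_inner \<Rightarrow> real"
  assumes "finite B" "span B = (UNIV :: 'a set)" and g: "convex_on (ball x r) g" and "r > 0"
  obtains e M where "0 < e" "e < r" "\<And>y. y \<in> cball x e \<Longrightarrow> \<bar>g y\<bar> \<le> M"
proof -
  obtain C :: "'a set" and K and c :: "'a \<Rightarrow> 'a \<Rightarrow> real" where C: "finite C" "K > 0" "\<And>x. (\<Sum>b\<in>C. c x b *\<^sub>R b) = x"
    "\<And>x b. b \<in> C \<Longrightarrow> \<bar>c x b\<bar> \<le> K * norm x"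
    by (rule finite_span_bounded_coordinates[OF assms(1,2)]) blast
  \<comment> \<open>Chosen so that \<open>d * norm b < r\<close> for all \<open>b\<close> in
    \<open>C\<close>, which keeps the endpoints of the segments inside the ball.\<close>
  define d where "d = r / (1 + (\<Sum>b\<in>C. norm b))"
  have S0: "0 \<le> (\<Sum>b\<in>C. norm b)" by (intro sum_nonneg) auto
  then have d: "d > 0" using \<open>r > 0\<close> by (simp add: d_def)
  have db: "d * norm b < r" if "b \<in> C" for b
  proof -
    have "norm b < 1 + (\<Sum>b\<in>C. norm b)"
      using member_le_sum[of b C norm] C(1) that by simp
    then have "d * norm b < d * (1 + (\<Sum>b\<in>C. norm b))" using d by simp
    also have "\<dots> = r" using S0 by (simp add: d_def)
    finally show ?thesis .
  qed
  define h where "h b = \<bar>g (x + d *\<^sub>R b)\<bar> + \<bar>g (x - d *\<^sub>R b)\<bar>" for b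
  define M where "M = \<bar>g x\<bar> + (\<Sum>b\<in>C. h b)"
  have hM: "h b \<le> M" if "b \<in> C" for b
    using member_le_sum[of b C h] that C(1) by (simp add: M_def h_def)
  define S where "S = {y \<in> ball x r. g y \<le> M}"
  have "convex S"
  proof (rule convexI)
    fix y z and a b :: real assume *: "y \<in> S" "z \<in> S" "0 \<le> a" "0 \<le> b" "a + b = 1"
    then have "g (a *\<^sub>R y + b *\<^sub>R z) \<le> a * g y + b * g z"
      using g by (auto simp: S_def convex_on_def)
    also have "\<dots> \<le> M"
      using * by (intro convex_bound_le) (auto simp: S_def)
    finally show "a *\<^sub>R y + b *\<^sub>R z \<in> S"
      using * convexD[OF convex_ball, of y x r z a b] by (auto simp: S_def)
  qed
  have xS: "x \<in> S"
  proof -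
    have "0 \<le> (\<Sum>b\<in>C. h b)" by (intro sum_nonneg) (simp add: h_def)
    then show ?thesis using \<open>r > 0\<close> by (simp add: S_def M_def)
  qed
  have ends: "x + d *\<^sub>R b \<in> S" "x - d *\<^sub>R b \<in> S" if "b \<in> C" for b
    using hM[OF that] db[OF that] d by (auto simp: S_def h_def dist_norm)
  have seg: "x + s *\<^sub>R b \<in> S" if "b \<in> C" "\<bar>s\<bar> \<le> d" for s b
  proof -
    \<comment> \<open>The weight solves \<open>(2 * a - 1) * d = s\<close>, so that
      \<open>x + s *\<^sub>R b\<close> is a convex combination of the two endpoints.\<close>
    define a where "a = (1 + s / d) / 2"
    have "0 \<le> a" "a \<le> 1" using that(2) d by (auto simp: a_def field_simps abs_le_iff)
    then have "a *\<^sub>R (x + d *\<^sub>R b) + (1 - a) *\<^sub>R (x - d *\<^sub>R b) \<in> S"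
      using \<open>convex S\<close> ends[OF that(1)] by (intro convexD) auto
    moreover have "a *\<^sub>R (x + d *\<^sub>R b) + (1 - a) *\<^sub>R (x - d *\<^sub>R b) = x + ((2 * a - 1) * d) *\<^sub>R b"
      by (simp add: algebra_simps scaleR_2[symmetric])
    moreover have "(2 * a - 1) * d = s" using d by (simp add: a_def add_divide_distrib)
    ultimately show ?thesis by simp
  qed
  define m where "m = real (card C)"
  \<comment> \<open>The first bound gives \<open>e < r\<close>. The second keeps every coordinate of
    \<open>y - x\<close> at most \<open>d\<close> after multiplication by \<open>m\<close>;
    \<open>m + 1\<close> avoids a zero denominator when \<open>C\<close> is empty.\<close>
  define e where "e = min (r / 2) (d / (K * (m + 1)))"
  have m: "m \<ge> 0" by (simp add: m_def)
  have e: "0 < e" "e < r" using \<open>r > 0\<close> d C(2) m by (auto simp: e_def)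
  have "y \<in> S" if y: "y \<in> cball x e" for y
  proof (cases "C = {}")
    case True
    then have "y = x" using C(3)[of y] C(3)[of x] by simp
    then show ?thesis using xS by simp
  next
    case False
    then have m1: "m > 0" using C(1) by (simp add: m_def card_gt_0_iff)
    have "\<bar>m * c (y - x) b\<bar> \<le> d" if b: "b \<in> C" for b
    proof -
      have "\<bar>m * c (y - x) b\<bar> \<le> m * (K * norm (y - x))"
        using C(4)[OF b] m by (simp add: abs_mult mult_left_mono)
      also have "\<dots> \<le> m * (K * (d / (K * (m + 1))))"
        using y C(2) m by (intro mult_left_mono) (auto simp: e_def dist_norm norm_minus_commute)
      also have "\<dots> = d * (m / (m + 1))" using C(2) by simp
      also have "\<dots> \<le> d * 1" using d m by (intro mult_left_mono) auto
      finally show ?thesis by simp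
    qed
    \<comment> \<open>The point \<open>y\<close> is the average of the \<open>m\<close> points
      \<open>x + (m * c (y - x) b) *\<^sub>R b\<close>, each of which lies on a segment in
      \<open>S\<close>.\<close>
    then have "(\<Sum>b\<in>C. (1 / m) *\<^sub>R (x + (m * c (y - x) b) *\<^sub>R b)) \<in> S"
      using C(1) \<open>convex S\<close> m1 seg by (intro convex_sum) (auto simp: m_def)
    also have "(\<Sum>b\<in>C. (1 / m) *\<^sub>R (x + (m * c (y - x) b) *\<^sub>R b))
        = (\<Sum>b\<in>C. (1 / m) *\<^sub>R x) + (\<Sum>b\<in>C. c (y - x) b *\<^sub>R b)"
      using m1 by (simp add: scaleR_add_right sum.distrib)
    also have "(\<Sum>b\<in>C. (1 / m) *\<^sub>R x) = x"
      using m1 by (simp add: sum_constant_scaleR m_def)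
    finally show ?thesis by (simp add: C(3))
  qed
  then have up: "g y \<le> M" if "y \<in> cball x e" for y
    using that by (auto simp: S_def)
  have "convex_on (cball x e) g"
    using g e by (rule_tac convex_on_subset[where T = "ball x r"]) auto
  from convex_bounds_lemma[OF this up]
  have "\<bar>g y\<bar> \<le> M + 2 * \<bar>g x\<bar>" if "y \<in> cball x e" for y
    using that by blast
  with e show thesis by (rule that)
qed

text \<open>On a ball inside the domain \<open>f\<close> is real-valued, since properness excludes
  the value \<open>-\<infinity>\<close>. Its real version is convex, hence locally bounded, and a
  bounded convex function on an open set is continuous.\<close>

lemma Gamma0_locally_bounded_continuous:
  fixes f :: "'a::real_inner \<Rightarrow> ereal"
  assumes "finite B" "span B = (UNIV :: 'a set)" and f: "f \<in> Gamma0" and x: "x \<in> interior (edom f)"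
  obtains r g M where "r > 0" "\<And>y. y \<in> ball x r \<Longrightarrow> f y = ereal (g y)"
    "\<And>y. y \<in> ball x r \<Longrightarrow> \<bar>g y\<bar> \<le> M" "continuous_on (ball x r) g"
proof -
  define g where "g y = real_of_ereal (f y)" for y
  obtain s where s: "s > 0" "ball x s \<subseteq> edom f"
    using x by (auto simp: mem_interior)
  have fg: "f y = ereal (g y)" if "y \<in> ball x s" for y
    using that s f by (cases "f y") (auto simp: g_def edom_def Gamma0_def proper_fun_def)
  have "convex_on (ball x s) g"
  proof
    fix t :: real and y z assume *: "0 < t" "t < 1" "y \<in> ball x s" "z \<in> ball x s"
    have "(1 - t) *\<^sub>R y + t *\<^sub>R z \<in> ball x s"
      using * convexD[OF convex_ball, of y x s z "1 - t" t] by auto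
    \<comment> \<open>\<open>econvex\<close> is used with weight \<open>1 - t\<close> on the first
      point, to match the order of weights in the goal.\<close>
    moreover have "f ((1 - t) *\<^sub>R y + (1 - (1 - t)) *\<^sub>R z)
        \<le> ereal (1 - t) * f y + ereal (1 - (1 - t)) * f z"
      using f * unfolding Gamma0_def econvex_def mem_Collect_eq
      by (metis diff_gt_0_iff_gt diff_less_eq less_add_same_cancel1)
    ultimately show "g ((1 - t) *\<^sub>R y + t *\<^sub>R z) \<le> (1 - t) * g y + t * g z"
      using * by (simp add: fg)
  qed simp
  then obtain r M where r: "0 < r" "r < s" "\<And>y. y \<in> cball x r \<Longrightarrow> \<bar>g y\<bar> \<le> M"
    by (rule convex_on_ball_locally_bounded[OF assms(1,2) _ s(1)]) blast
  have "convex_on (ball x r) g"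
    using \<open>convex_on (ball x s) g\<close> r by (rule_tac convex_on_subset[where T = "ball x s"]) auto
  then have "continuous_on (ball x r) g"
    using r by (intro convex_on_bounded_continuous[of _ _ M]) auto
  then show thesis using r by (intro that[of r g M] fg) auto
qed

section \<open>Subgradients: bound, closed graph, existence\<close>

text \<open>A step of length \<open>r / 2\<close> from \<open>w\<close> in the direction of
  \<open>u\<close> stays in the ball and raises \<open>g\<close> by at least
  \<open>r / 2 * norm u\<close>, while \<open>g\<close> varies by at most
  \<open>2 * M\<close>.\<close>

lemma subdiff_norm_bound:
  fixes f :: "'a::real_inner \<Rightarrow> ereal"
  assumes "r > 0" and fg: "\<And>y. y \<in> ball x r \<Longrightarrow> f y = ereal (g y)"
    and M: "\<And>y. y \<in> ball x r \<Longrightarrow> \<bar>g y\<bar> \<le> M"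
    and w: "w \<in> ball x (r / 2)" and u: "u \<in> subdiff f w"
  shows "norm u \<le> 4 * M / r"
proof (cases "u = 0")
  case True
  have "0 \<le> M" using M[of x] \<open>r > 0\<close> by auto
  then show ?thesis using True \<open>r > 0\<close> by simp
next
  case False
  define y where "y = w + (r / 2 / norm u) *\<^sub>R u"
  have "dist w y = r / 2" using False \<open>r > 0\<close> by (simp add: y_def dist_norm)
  then have y: "y \<in> ball x r" using w dist_triangle[of x y w] by auto
  have w': "w \<in> ball x r" using w \<open>r > 0\<close> by auto
  have "ereal ((y - w) \<bullet> u) + f w \<le> f y" using u by (simp add: subdiff_def)
  then have "(y - w) \<bullet> u + g w \<le> g y" using fg[OF y] fg[OF w'] by simp
  moreover have "(y - w) \<bullet> u = r / 2 * norm u"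
    using False by (simp add: y_def power2_norm_eq_inner[symmetric] power2_eq_square)
  ultimately show ?thesis using M[OF y] M[OF w'] \<open>r > 0\<close> by (simp add: field_simps)
qed

text \<open>For each fixed \<open>y\<close> the subgradient inequality at \<open>w n\<close> passes
  to the limit.\<close>

lemma subdiff_sequentially_closed:
  fixes f :: "'a::real_inner \<Rightarrow> ereal"
  assumes w: "w \<longlonglongrightarrow> x" and u: "u \<longlonglongrightarrow> l" and g: "(\<lambda>n. g (w n)) \<longlonglongrightarrow> g x"
    and fw: "\<And>n. f (w n) = ereal (g (w n))" and fx: "f x = ereal (g x)"
    and uw: "\<And>n. u n \<in> subdiff f (w n)"
  shows "l \<in> subdiff f x"
proof -
  have "ereal ((y - x) \<bullet> l) + f x \<le> f y" for y
  proof -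
    have *: "ereal ((y - w n) \<bullet> u n + g (w n)) \<le> f y" for n
      using uw[of n] by (auto simp: subdiff_def fw)
    have lim: "(\<lambda>n. (y - w n) \<bullet> u n + g (w n)) \<longlonglongrightarrow> (y - x) \<bullet> l + g x"
      by (intro tendsto_intros w u g)
    show ?thesis
    proof (cases "f y")
      case (real v)
      then have "(y - x) \<bullet> l + g x \<le> v" using * by (intro LIMSEQ_le_const2[OF lim]) auto
      then show ?thesis using real fx by simp
    \<comment> \<open>The value \<open>\<infinity>\<close> is trivial, and
      \<open>-\<infinity>\<close> is impossible because \<open>*\<close> bounds \<open>f y\<close>
      below by a real number.\<close>
    qed (use *[of 0] in auto)
  qed
  then show ?thesis by (simp add: subdiff_def)
qed

text \<open>The last hypothesis says that \<open>z\<close> is a local minimiser of \<open>f + c/2 |\<cdot> - x|\<^sup>2\<close>;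
  it is solved for \<open>f y\<close> to keep the arithmetic real.\<close>

lemma proximal_subgradient:
  fixes f :: "'a::real_inner \<Rightarrow> ereal"
  assumes f: "f \<in> Gamma0" and "s > 0" and fz: "f z = ereal v"
    and min: "\<And>y. y \<in> ball z s \<Longrightarrow> ereal (v + c / 2 * (norm (z - x))\<^sup>2 - c / 2 * (norm (y - x))\<^sup>2) \<le> f y"
  shows "c *\<^sub>R (x - z) \<in> subdiff f z"
proof -
  have "ereal ((y - z) \<bullet> (c *\<^sub>R (x - z))) + f z \<le> f y" for y
  proof (cases "f y")
    case (real b)
    define D where "D = y - z"
    \<comment> \<open>Minimality of \<open>z\<close> is compared with convexity of \<open>f\<close>
      at \<open>q = z + t *\<^sub>R D\<close>, where small \<open>t\<close> keeps \<open>q\<close>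
      in the ball. The result is \<open>t * p t \<le> 0\<close>. Division by \<open>t\<close> and
      the limit from the right yield \<open>p 0 \<le> 0\<close>, which is the subgradient inequality
      at \<open>y\<close>.\<close>
    define p where "p t = v - b - c * (D \<bullet> (z - x)) - c / 2 * t * (norm D)\<^sup>2" for t :: real
    have "p t \<le> 0" if t: "0 < t" "t < 1" "t * norm D < s" for t
    proof -
      define q where "q = z + t *\<^sub>R D"
      have "q \<in> ball z s" using t by (simp add: q_def dist_norm)
      then have "ereal (v + c / 2 * (norm (z - x))\<^sup>2 - c / 2 * (norm (q - x))\<^sup>2) \<le> f q"
        by (rule min)
      also have "q = t *\<^sub>R y + (1 - t) *\<^sub>R z" by (simp add: q_def D_def algebra_simps)
      also have "f \<dots> \<le> ereal t * f y + ereal (1 - t) * f z"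
        using f t by (simp add: Gamma0_def econvex_def)
      finally have "v + c / 2 * (norm (z - x))\<^sup>2 - c / 2 * (norm (q - x))\<^sup>2 \<le> t * b + (1 - t) * v"
        by (simp add: real fz q_def D_def algebra_simps)
      moreover have "(norm (q - x))\<^sup>2 = (norm (z - x))\<^sup>2 + 2 * t * (D \<bullet> (z - x)) + t\<^sup>2 * (norm D)\<^sup>2"
      proof -
        have "q - x = (z - x) + t *\<^sub>R D" by (simp add: q_def)
        then show ?thesis unfolding power2_norm_eq_inner
          by (simp only: inner_add_left inner_add_right inner_scaleR_left inner_scaleR_right
              inner_commute[of "z - x" D]) (simp add: algebra_simps power2_eq_square)
      qed
      ultimately have "v + c / 2 * (norm (z - x))\<^sup>2 - c / 2 * ((norm (z - x))\<^sup>2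
          + 2 * t * (D \<bullet> (z - x)) + t\<^sup>2 * (norm D)\<^sup>2) \<le> t * b + (1 - t) * v"
        by metis
      then have "t * p t \<le> 0"
        by (simp add: p_def algebra_simps power2_eq_square)
      then show ?thesis using t by (simp add: mult_le_0_iff)
    qed
    moreover have "\<forall>\<^sub>F t in at_right 0. 0 < t \<and> t < 1 \<and> t * norm D < s"
    proof -
      have "((\<lambda>t. t * norm D) \<longlongrightarrow> 0 * norm D) (at_right 0)" by (intro tendsto_intros)
      then have "\<forall>\<^sub>F t in at_right 0. t * norm D < s"
        using \<open>s > 0\<close> by (intro order_tendstoD) auto
      moreover have "\<forall>\<^sub>F t in at_right (0::real). 0 < t \<and> t < 1"
        using eventually_at_right_less[of "0::real"] eventually_at_right_real[of 0 1]
        by (auto elim: eventually_elim2)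
      ultimately show ?thesis by eventually_elim auto
    qed
    ultimately have "\<forall>\<^sub>F t in at_right 0. p t \<le> 0" by (auto elim: eventually_mono)
    moreover have "(p \<longlongrightarrow> p 0) (at_right 0)" unfolding p_def by (intro tendsto_intros)
    ultimately have "p 0 \<le> 0" by (intro tendsto_upperbound[of p "p 0" "at_right 0"]) auto
    then show ?thesis using real fz by (simp add: p_def D_def inner_simps algebra_simps)
  next
    case MInf
    then show ?thesis using f by (simp add: Gamma0_def proper_fun_def)
  qed simp
  then show ?thesis by (simp add: subdiff_def)
qed

text \<open>A large penalty forces the minimiser over the closed ball of radius \<open>r / 2\<close>
  into its interior, so it is a local minimiser and supplies a subgradient. The uniform bound on
  these subgradients makes the minimisers tend to \<open>x\<close> and a subsequence of the
  subgradients converge.\<close>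

lemma subdiff_nonempty:
  fixes f :: "'a::real_inner \<Rightarrow> ereal"
  assumes B: "finite B" "span B = (UNIV :: 'a set)" and f: "f \<in> Gamma0"
    and x: "x \<in> interior (edom f)"
  shows "subdiff f x \<noteq> {}"
proof -
  obtain r g M where r: "r > 0" and fg: "\<And>y. y \<in> ball x r \<Longrightarrow> f y = ereal (g y)"
    and M: "\<And>y. y \<in> ball x r \<Longrightarrow> \<bar>g y\<bar> \<le> M" and cont: "continuous_on (ball x r) g"
    by (rule Gamma0_locally_bounded_continuous[OF B f x]) blast
  \<comment> \<open>At distance \<open>r / 2\<close> from \<open>x\<close> the penalty is
    \<open>c n * r\<^sup>2 / 8\<close>, which exceeds the greatest possible variation
    \<open>2 * M\<close> of \<open>g\<close>. The term \<open>n\<close> drives \<open>c n\<close> to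
    infinity.\<close>
  define c where "c n = 16 * M / r\<^sup>2 + 1 + real n" for n :: nat
  have "0 \<le> M" using M[of x] r by auto
  then have "0 \<le> 16 * M / r\<^sup>2" by simp
  then have c: "c n > 0" "c n > 16 * M / r\<^sup>2" for n
    unfolding c_def by linarith+
  have "\<exists>z. z \<in> ball x (r / 2) \<and> c n *\<^sub>R (x - z) \<in> subdiff f z" for n
  proof -
    define k where "k y = g y + c n / 2 * (norm (y - x))\<^sup>2" for y
    have sub: "cball x (r / 2) \<subseteq> ball x r" using r by auto
    have "continuous_on (cball x (r / 2)) k"
      unfolding k_def by (intro continuous_intros continuous_on_subset[OF cont sub])
    then obtain z where z: "z \<in> cball x (r / 2)" "\<And>y. y \<in> cball x (r / 2) \<Longrightarrow> k z \<le> k y"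
      using continuous_attains_inf[OF compact_cball_finite_span[OF B]] r
      by (metis cball_eq_empty divide_less_0_iff not_less_iff_gr_or_eq zero_less_numeral)
    have zr: "z \<in> ball x r" using z(1) sub by auto
    have "k z \<le> k x" using z(2) r by simp
    then have "c n / 2 * (norm (z - x))\<^sup>2 \<le> 2 * M"
      using M[OF zr] M[of x] r by (simp add: k_def)
    moreover have "2 * M < c n / 2 * (r / 2)\<^sup>2"
      using c(2)[of n] r by (simp add: field_simps power2_eq_square)
    ultimately have "c n / 2 * (norm (z - x))\<^sup>2 < c n / 2 * (r / 2)\<^sup>2" by simp
    then have "(norm (z - x))\<^sup>2 < (r / 2)\<^sup>2" using c(1)[of n] by simp
    then have "norm (z - x) < r / 2" using r by (auto dest: power2_less_imp_less)
    then have zb: "z \<in> ball x (r / 2)" by (simp add: dist_norm norm_minus_commute)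
    have "c n *\<^sub>R (x - z) \<in> subdiff f z"
    proof (rule proximal_subgradient[OF f])
      show "0 < r / 2 - dist x z" using zb by simp
      show "f z = ereal (g z)" by (rule fg[OF zr])
      fix y assume "y \<in> ball z (r / 2 - dist x z)"
      then have y: "y \<in> cball x (r / 2)" using dist_triangle[of x y z] by auto
      then have "f y = ereal (g y)" using fg sub by blast
      then show "ereal (g z + c n / 2 * (norm (z - x))\<^sup>2 - c n / 2 * (norm (y - x))\<^sup>2) \<le> f y"
        using z(2)[OF y] by (simp add: k_def)
    qed
    with zb show ?thesis by blast
  qed
  then obtain z where z: "\<And>n. z n \<in> ball x (r / 2)" "\<And>n. c n *\<^sub>R (x - z n) \<in> subdiff f (z n)"
    by metis
  define u where "u n = c n *\<^sub>R (x - z n)" for n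
  have u: "norm (u n) \<le> 4 * M / r" for n
    unfolding u_def using subdiff_norm_bound[OF r fg M z(1) z(2)] .
  have "z \<longlonglongrightarrow> x"
  proof -
    \<comment> \<open>The norm of \<open>u n\<close> is \<open>c n\<close> times the distance from
      \<open>z n\<close> to \<open>x\<close>; it stays bounded while
      \<open>c n \<ge> n\<close>.\<close>
    have "norm (z n - x) \<le> (4 * M / r) / real n" if "n > 0" for n
    proof -
      have "real n * norm (z n - x) \<le> c n * norm (z n - x)"
        using \<open>0 \<le> M\<close> r by (intro mult_right_mono) (auto simp: c_def)
      also have "\<dots> = norm (u n)" using c(1)[of n] by (simp add: u_def norm_minus_commute)
      also have "\<dots> \<le> 4 * M / r" by (rule u)
      finally show ?thesis using that by (simp add: pos_le_divide_eq mult.commute del: divide_divide_eq_left)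
    qed
    then have "(\<lambda>n. z n - x) \<longlonglongrightarrow> 0"
      by (intro Lim_null_comparison[OF _ lim_const_over_n[of "4 * M / r"]])
        (auto simp: eventually_sequentially intro!: exI[of _ 1])
    then show ?thesis by (simp add: LIM_zero_iff)
  qed
  obtain l q where l: "strict_mono q" "(u \<circ> q) \<longlonglongrightarrow> l"
    using compact_cball_finite_span[OF B, of 0 "4 * M / r"] u unfolding compact_def
    by (metis mem_cball_0)
  have zq: "(\<lambda>n. z (q n)) \<longlonglongrightarrow> x"
    using LIMSEQ_subseq_LIMSEQ[OF \<open>z \<longlonglongrightarrow> x\<close> l(1)] by (simp add: o_def)
  have zr: "z n \<in> ball x r" for n using z(1)[of n] r by auto
  have "l \<in> subdiff f x"
  proof (rule subdiff_sequentially_closed[where w = "\<lambda>n. z (q n)" and u = "\<lambda>n. u (q n)" and g = g])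
    show "(\<lambda>n. g (z (q n))) \<longlonglongrightarrow> g x"
      using continuous_on_tendsto_compose[OF cont zq] r zr by simp
  qed (use l zq z r zr fg in \<open>auto simp: o_def u_def\<close>)
  then show ?thesis by auto
qed

section \<open>The subgradient projector\<close>

text \<open>By Cauchy--Schwarz, the subgradient inequality at \<open>p\<close> gives \<open>f w / |u| \<le> |w - p|\<close>.\<close>

lemma subgrad_proj_dist_le:
  fixes f :: "'a::real_inner \<Rightarrow> ereal"
  assumes f: "proper_fun f" and p: "f p \<le> 0" and q: "q \<in> subgrad_proj f w"
  shows "dist w q \<le> dist w p"
proof (cases "f w \<le> 0")
  case True
  then show ?thesis using q by (simp add: subgrad_proj_def)
next
  case False
  then obtain u where u: "u \<in> subdiff f w"
    and q: "q = w - (real_of_ereal (f w) / (norm u)\<^sup>2) *\<^sub>R u"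
    using q by (auto simp: subgrad_proj_def)
  have "u \<noteq> 0" using False p u by (intro subdiff_nonzero[of f w u]) (auto simp: lev_le0_def)
  have "ereal ((p - w) \<bullet> u) + f w \<le> f p" using u by (simp add: subdiff_def)
  then have *: "ereal ((p - w) \<bullet> u) + f w \<le> 0" using p by (rule order_trans)
  then obtain v where v: "f w = ereal v" using f False by (cases "f w") (auto simp: proper_fun_def)
  have "v > 0" using False v by simp
  have "v \<le> (w - p) \<bullet> u" using * v by (simp add: zero_ereal_def inner_simps)
  also have "\<dots> \<le> norm (w - p) * norm u" by (rule norm_cauchy_schwarz)
  finally have "v / norm u \<le> dist w p" using \<open>u \<noteq> 0\<close> by (simp add: dist_norm field_simps)
  moreover have "dist w q = v / norm u"
    using \<open>u \<noteq> 0\<close> \<open>v > 0\<close> by (simp add: q v dist_norm power2_eq_square)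
  ultimately show ?thesis by simp
qed

text \<open>Sequential form of upper semicontinuity where \<open>f\<close> is positive: a
  subsequence of the bounded subgradients behind \<open>p n\<close> converges to a subgradient at
  \<open>x\<close>, and the projection formula passes to the limit.\<close>

lemma subgrad_proj_usc_sequentially:
  fixes f :: "'a::real_inner \<Rightarrow> ereal"
  assumes B: "finite B" "span B = (UNIV :: 'a set)" and f: "f \<in> Gamma0"
    and lev: "lev_le0 f \<noteq> {}" and x: "x \<in> interior (edom f)" and pos: "f x > 0"
    and w: "w \<longlonglongrightarrow> x" and p: "\<And>n. p n \<in> subgrad_proj f (w n)"
  obtains s :: "nat \<Rightarrow> nat" and l where "strict_mono s" "(p \<circ> s) \<longlonglongrightarrow> l" "l \<in> subgrad_proj f x"
proof -
  obtain r g M where r: "r > 0" and fg: "\<And>y. y \<in> ball x r \<Longrightarrow> f y = ereal (g y)"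
    and M: "\<And>y. y \<in> ball x r \<Longrightarrow> \<bar>g y\<bar> \<le> M" and cont: "continuous_on (ball x r) g"
    by (rule Gamma0_locally_bounded_continuous[OF B f x]) blast
  have xr: "x \<in> ball x r" using r by simp
  have gx: "g x > 0" using pos fg[OF xr] by simp
  have near: "\<forall>\<^sub>F n in sequentially. w n \<in> ball x (r / 2)"
    using tendstoD[OF w, of "r / 2"] r by (simp add: dist_commute)
  then have near': "\<forall>\<^sub>F n in sequentially. w n \<in> ball x r"
    by eventually_elim (use r in auto)
  have gw: "(\<lambda>n. g (w n)) \<longlonglongrightarrow> g x"
    using continuous_on_tendsto_compose[OF cont w xr near'] .
  then have "\<forall>\<^sub>F n in sequentially. g (w n) > 0" using gx by (rule order_tendstoD)
  with near obtain N where N: "\<And>n. n \<ge> N \<Longrightarrow> w n \<in> ball x (r / 2) \<and> g (w n) > 0"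
    unfolding eventually_sequentially by (metis (no_types, lifting) nat_le_linear order_trans)
  \<comment> \<open>Dropping the first \<open>N\<close> terms puts every point in the region where
    subgradients are bounded and \<open>f\<close> is positive, so each projection comes from a
    subgradient.\<close>
  define W where "W n = w (n + N)" for n
  have W: "W n \<in> ball x (r / 2)" "W n \<in> ball x r" "g (W n) > 0" for n
    using N[of "n + N"] r by (auto simp: W_def)
  have Wx: "W \<longlonglongrightarrow> x" and gW: "(\<lambda>n. g (W n)) \<longlonglongrightarrow> g x"
    unfolding W_def using LIMSEQ_ignore_initial_segment[OF w] LIMSEQ_ignore_initial_segment[OF gw] by auto
  have "\<exists>u. u \<in> subdiff f (W n) \<and> p (n + N) = W n - (g (W n) / (norm u)\<^sup>2) *\<^sub>R u" for n
    using p[of "n + N"] fg[OF W(2)[of n]] W(3)[of n] by (auto simp: subgrad_proj_def W_def)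
  then obtain u where u: "\<And>n. u n \<in> subdiff f (W n)"
    "\<And>n. p (n + N) = W n - (g (W n) / (norm (u n))\<^sup>2) *\<^sub>R u n" by metis
  have "norm (u n) \<le> 4 * M / r" for n
    using subdiff_norm_bound[OF r fg M W(1) u(1)] .
  then obtain l q where q: "strict_mono q" "(u \<circ> q) \<longlonglongrightarrow> l"
    using compact_cball_finite_span[OF B, of 0 "4 * M / r"] unfolding compact_def
    by (metis mem_cball_0)
  have Wq: "(\<lambda>n. W (q n)) \<longlonglongrightarrow> x" and gq: "(\<lambda>n. g (W (q n))) \<longlonglongrightarrow> g x"
    and uq: "(\<lambda>n. u (q n)) \<longlonglongrightarrow> l"
    using LIMSEQ_subseq_LIMSEQ[OF Wx q(1)] LIMSEQ_subseq_LIMSEQ[OF gW q(1)] q(2) by (simp_all add: o_def)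
  have l: "l \<in> subdiff f x"
    using Wq uq gq fg[OF W(2)] fg[OF xr] u(1) by (rule subdiff_sequentially_closed)
  \<comment> \<open>This makes the quotient by the squared norm continuous at the limit.\<close>
  have "l \<noteq> 0" by (rule subdiff_nonzero[OF lev pos l])
  then have "(\<lambda>n. W (q n) - (g (W (q n)) / (norm (u (q n)))\<^sup>2) *\<^sub>R u (q n))
      \<longlonglongrightarrow> x - (g x / (norm l)\<^sup>2) *\<^sub>R l"
    by (intro tendsto_intros Wq uq gq) auto
  then have "(p \<circ> (\<lambda>n. q n + N)) \<longlonglongrightarrow> x - (g x / (norm l)\<^sup>2) *\<^sub>R l"
    by (simp add: o_def u(2))
  moreover have "strict_mono (\<lambda>n. q n + N)" using q(1) by (simp add: strict_mono_def)
  moreover have "x - (g x / (norm l)\<^sup>2) *\<^sub>R l \<in> subgrad_proj f x"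
    using l gx fg[OF xr] by (auto simp: subgrad_proj_def)
  ultimately show thesis using that by blast
qed

section \<open>Upper semicontinuity on the interior of the domain\<close>

theorem mainTheorem19:
  fixes f :: "'a::{real_inner, complete_space} \<Rightarrow> ereal"
  assumes findim: "\<exists>B :: 'a set. finite B \<and> span B = UNIV"
    and f: "f \<in> Gamma0"
    and lev: "lev_le0 f \<noteq> {}"
  shows "\<forall>x \<in> interior (edom f). upper_semicont_at (subgrad_proj f) x"
proof
  fix x assume x: "x \<in> interior (edom f)"
  obtain B :: "'a set" where B: "finite B" "span B = UNIV" using findim by blast
  show "upper_semicont_at (subgrad_proj f) x"
    unfolding upper_semicont_at_def
  proof (intro conjI allI impI)
    show "subgrad_proj f x \<noteq> {}"
      using subdiff_nonempty[OF B f x] by (auto simp: subgrad_proj_def)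
    fix V assume V: "subgrad_proj f x \<subseteq> interior V"
    show "\<exists>W. x \<in> interior W \<and> (\<Union>w\<in>W. subgrad_proj f w) \<subseteq> V"
    proof (cases "f x \<le> 0")
      case True
      then have "x \<in> interior V" using V by (simp add: subgrad_proj_def)
      then obtain e where e: "e > 0" "ball x e \<subseteq> V" by (auto simp: mem_interior)
      \<comment> \<open>Here \<open>x\<close> itself serves as the point where \<open>f\<close> is
        nonpositive, so \<open>q\<close> is at most twice as far from \<open>x\<close> as
        \<open>w\<close> is; hence the radius \<open>e / 2\<close>.\<close>
      have "q \<in> V" if w: "w \<in> ball x (e / 2)" and q: "q \<in> subgrad_proj f w" for w q
      proof -
        have "dist w q \<le> dist w x"
          using f True q by (intro subgrad_proj_dist_le) (auto simp: Gamma0_def)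
        then have "dist x q < e" using w dist_triangle[of x q w] by (simp add: dist_commute)
        then show ?thesis using e by auto
      qed
      then show ?thesis using e by (intro exI[of _ "ball x (e / 2)"]) auto
    next
      case False
      show ?thesis
      proof (rule ccontr)
        assume contra: "\<not> ?thesis"
        \<comment> \<open>Shrinking balls are tried as \<open>W\<close>; the failure of each gives a
          sequence tending to \<open>x\<close> whose projections \<open>q n\<close> avoid
          \<open>V\<close>.\<close>
        have "\<exists>w q. w \<in> ball x (inverse (real (Suc n))) \<and> q \<in> subgrad_proj f w \<and> q \<notin> V" for n
        proof -
          have "x \<in> interior (ball x (inverse (real (Suc n))))" by (simp del: of_nat_Suc)
          then show ?thesis using contra by blast
        qed
        then obtain w q where wq: "\<And>n. w n \<in> ball x (inverse (real (Suc n)))"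
          "\<And>n. q n \<in> subgrad_proj f (w n)" "\<And>n. q n \<notin> V" by metis
        have "w \<longlonglongrightarrow> x"
        proof (rule tendstoI)
          fix e :: real assume "e > 0"
          from order_tendstoD(2)[OF LIMSEQ_inverse_real_of_nat this]
          show "\<forall>\<^sub>F n in sequentially. dist (w n) x < e"
          proof eventually_elim
            case (elim n)
            then show ?case using wq(1)[of n] by (simp add: dist_commute)
          qed
        qed
        then obtain s l where "strict_mono (s :: nat \<Rightarrow> nat)"
          and l: "(q \<circ> s) \<longlonglongrightarrow> l" "l \<in> subgrad_proj f x"
          using False by (rule_tac subgrad_proj_usc_sequentially[OF B f lev x _ _ wq(2)]) auto
        \<comment> \<open>The limit \<open>l\<close> lies in the open set \<open>interior V\<close>,
          so the subsequence eventually enters \<open>V\<close>, which it was chosen to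
          avoid.\<close>
        then have "\<forall>\<^sub>F n in sequentially. (q \<circ> s) n \<in> interior V"
          using V by (intro topological_tendstoD[OF l(1)]) auto
        then have "\<forall>\<^sub>F n in sequentially. False"
          by eventually_elim (use wq(3) interior_subset in auto)
        then show False by simp
      qed
    qed
  qed
qed

end
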